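(* Let $G$ be a simple, finite, connected partial 2-tree with edge weights $w:E(G)\to\mathbb{N}$ and a total order on $V(G)$, which is not outerplanar. Let $u,v\in V(G)$ be such that $G$ contains a subdivision of $K_{2,3}$ with branch-vertex bipartition $(\{u,v\},\{x,y,z\})$ and $G-\{u,v\}$ has at least three components. Let $P=lsp(u,v)$ and let $H$ be a component of $G-\{u,v\}$ with $V(P)\cap V(H)=\emptyset$ and $E(P)\cap E(H)=\emptyset$. Let $G_1$ be the graph with $V(G_1)=V(H)\cup V(P)$ and $E(G_1)=E(H)\cup E(P)\cup\{(a,b)\in E(G): a\in V(H), b\in\{u,v\}\}$, and let $G_2=G[V(G)\setminus V(H)]$, each with the restricted weights and induced order. Then $LSC(G)=LSC(G_1)\uplus LSC(G_2)$ (disjoint union).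
   Context: A partial 2-tree is a subgraph of a 2-tree, where 2-trees are built from $K_3$ by repeatedly adding a vertex adjacent to both endpoints of an existing edge. For a path $Q$, $w(Q)=\sum_{e\in E(Q)}w(e)$. In a weighted graph with totally ordered vertices, the lex shortest $a$–$b$ path is the unique $a$–$b$ path $Q$ such that for every other $a$–$b$ path $Q'$ exactly one of: (1) $w(Q')>w(Q)$; (2) $w(Q')=w(Q)$ and $|E(Q')|>|E(Q)|$; (3) $w(Q')=w(Q)$, $|E(Q')|=|E(Q)|$ and $\min(V(Q')\setminus V(Q))>\min(V(Q)\setminus V(Q'))$; in $G$ it is denoted $lsp(a,b)$. A cycle $C$ of a graph is lex short in that graph if for all $a,b\in V(C)$ the lex shortest $a$–$b$ path of that graph lies in $C$. $LSC(F)$ denotes the set of lex short cycles of a graph $F$. $G[X]$ is the induced subgraph on $X$. *)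

theory Defs
  imports "HOL-Analysis.Analysis"
begin

text \<open>
  Edges are two-element vertex sets. Paths, cycles, components and subdivisions are all
  graphs in their own right, so that inclusion between them is \<open>subgraph\<close>.
\<close>

record 'a sgraph =
  verts :: "'a set"
  edges :: "'a set set"

definition simple_graph :: "'a sgraph \<Rightarrow> bool" where
  "simple_graph G \<longleftrightarrow> (\<forall>e\<in>edges G. e \<subseteq> verts G \<and> card e = 2)"

definition subgraph :: "'a sgraph \<Rightarrow> 'a sgraph \<Rightarrow> bool" where
  "subgraph H G \<longleftrightarrow> simple_graph H \<and> verts H \<subseteq> verts G \<and> edges H \<subseteq> edges G"

definition induced :: "'a sgraph \<Rightarrow> 'a set \<Rightarrow> 'a sgraph" where
  "induced G X = \<lparr>verts = verts G \<inter> X, edges = {e \<in> edges G. e \<subseteq> X}\<rparr>"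

definition delete_verts :: "'a sgraph \<Rightarrow> 'a set \<Rightarrow> 'a sgraph" where
  "delete_verts G X = induced G (verts G - X)"

definition map_sgraph :: "('a \<Rightarrow> 'b) \<Rightarrow> 'a sgraph \<Rightarrow> 'b sgraph" where
  "map_sgraph f G = \<lparr>verts = f ` verts G, edges = (\<lambda>e. f ` e) ` edges G\<rparr>"


fun walk_edges :: "'a list \<Rightarrow> 'a set set" where
  "walk_edges (a # b # xs) = insert {a, b} (walk_edges (b # xs))"
| "walk_edges _ = {}"

definition is_path :: "'a \<Rightarrow> 'a \<Rightarrow> 'a sgraph \<Rightarrow> bool" where
  "is_path a b Q \<longleftrightarrow> (\<exists>xs. xs \<noteq> [] \<and> distinct xs \<and> hd xs = a \<and> last xs = b \<and>
     Q = \<lparr>verts = set xs, edges = walk_edges xs\<rparr>)"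

definition is_cycle :: "'a sgraph \<Rightarrow> bool" where
  "is_cycle C \<longleftrightarrow> (\<exists>xs. 3 \<le> length xs \<and> distinct xs \<and>
     C = \<lparr>verts = set xs, edges = insert {last xs, hd xs} (walk_edges xs)\<rparr>)"

definition paths_of :: "'a sgraph \<Rightarrow> 'a \<Rightarrow> 'a \<Rightarrow> 'a sgraph set" where
  "paths_of G a b = {Q. is_path a b Q \<and> subgraph Q G}"

definition connected_graph :: "'a sgraph \<Rightarrow> bool" where
  "connected_graph G \<longleftrightarrow> verts G \<noteq> {} \<and> (\<forall>a\<in>verts G. \<forall>b\<in>verts G. paths_of G a b \<noteq> {})"

definition components_of :: "'a sgraph \<Rightarrow> 'a sgraph set" where
  "components_of G = {H. subgraph H G \<and> connected_graph H \<and>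
     (\<forall>K. subgraph K G \<and> connected_graph K \<and> subgraph H K \<longrightarrow> K = H)}"


inductive two_tree :: "'a sgraph \<Rightarrow> bool" where
  triangle: "distinct [a, b, c] \<Longrightarrow>
    two_tree \<lparr>verts = {a, b, c}, edges = {{a, b}, {b, c}, {a, c}}\<rparr>"
| extend: "two_tree T \<Longrightarrow> {a, b} \<in> edges T \<Longrightarrow> c \<notin> verts T \<Longrightarrow>
    two_tree \<lparr>verts = insert c (verts T), edges = edges T \<union> {{a, c}, {b, c}}\<rparr>"

text \<open>
  The 2-tree lives on natural numbers, so that it may have vertices outside \<open>G\<close> even when the
  vertex type of \<open>G\<close> is finite. All 2-trees are finite, so this loses no generality.
\<close>

definition partial_two_tree :: "'a sgraph \<Rightarrow> bool" where
  "partial_two_tree G \<longleftrightarrow> (\<exists>(T :: nat sgraph) f. two_tree T \<and> inj_on f (verts G) \<and>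
     subgraph (map_sgraph f G) T)"


definition complete_bipartite :: "'a set \<Rightarrow> 'a set \<Rightarrow> 'a sgraph" where
  "complete_bipartite A B = \<lparr>verts = A \<union> B, edges = {{a, b} | a b. a \<in> A \<and> b \<in> B}\<rparr>"

text \<open>
  \<open>S\<close> arises from \<open>K\<close> by replacing each edge \<open>e\<close> with a path \<open>R e\<close> between its ends; the
  branch vertices are the vertices of \<open>K\<close>. Edge-disjointness of the paths follows from the
  condition on their vertices, since distinct edges of a simple graph share at most one vertex.
\<close>

definition subdivision_of :: "'a sgraph \<Rightarrow> 'a sgraph \<Rightarrow> bool" where
  "subdivision_of K S \<longleftrightarrow> (\<exists>R.
     (\<forall>a b. {a, b} \<in> edges K \<longrightarrow> is_path a b (R {a, b})) \<and>
     (\<forall>e\<in>edges K. verts (R e) \<inter> verts K = e) \<and>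
     (\<forall>e\<in>edges K. \<forall>f\<in>edges K. e \<noteq> f \<longrightarrow> verts (R e) \<inter> verts (R f) \<subseteq> e \<inter> f) \<and>
     S = \<lparr>verts = verts K \<union> (\<Union>e\<in>edges K. verts (R e)), edges = (\<Union>e\<in>edges K. edges (R e))\<rparr>)"


text \<open>
  Drawings in the plane, with vertices placed by \<open>p\<close> and the edge \<open>e\<close> drawn as the arc \<open>g e\<close>.
\<close>

definition plane_drawing :: "'a sgraph \<Rightarrow> ('a \<Rightarrow> complex) \<Rightarrow> ('a set \<Rightarrow> real \<Rightarrow> complex) \<Rightarrow> bool" where
  "plane_drawing G p g \<longleftrightarrow> inj_on p (verts G) \<and>
     (\<forall>e\<in>edges G. arc (g e) \<and> {pathstart (g e), pathfinish (g e)} = p ` e \<and>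
        path_image (g e) \<inter> p ` verts G = p ` e) \<and>
     (\<forall>e\<in>edges G. \<forall>f\<in>edges G. e \<noteq> f \<longrightarrow>
        path_image (g e) \<inter> path_image (g f) \<subseteq> p ` (e \<inter> f))"

definition drawing_image :: "'a sgraph \<Rightarrow> ('a \<Rightarrow> complex) \<Rightarrow> ('a set \<Rightarrow> real \<Rightarrow> complex) \<Rightarrow> complex set" where
  "drawing_image G p g = p ` verts G \<union> (\<Union>e\<in>edges G. path_image (g e))"

text \<open>
  For a finite graph the image of a drawing is compact, so \<open>outside\<close> of it is the outer face.
\<close>

definition outerplanar :: "'a sgraph \<Rightarrow> bool" where
  "outerplanar G \<longleftrightarrow> (\<exists>p g. plane_drawing G p g \<and>
     p ` verts G \<subseteq> frontier (outside (drawing_image G p g)))"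


definition path_weight :: "('a set \<Rightarrow> nat) \<Rightarrow> 'a sgraph \<Rightarrow> nat" where
  "path_weight w Q = (\<Sum>e\<in>edges Q. w e)"

text \<open>
  The three alternatives exclude each other, so their disjunction says that exactly one holds.
  In the third one, the two differences have the same size, because the paths have equally many
  edges. If both are empty, the strict inequality is false, so two different paths on the same
  vertices are never separated by it.
\<close>

definition lex_less :: "('a::linorder set \<Rightarrow> nat) \<Rightarrow> 'a sgraph \<Rightarrow> 'a sgraph \<Rightarrow> bool" where
  "lex_less w Q Q' \<longleftrightarrow>
     path_weight w Q' > path_weight w Q \<or>
     path_weight w Q' = path_weight w Q \<and> card (edges Q') > card (edges Q) \<or>
     path_weight w Q' = path_weight w Q \<and> card (edges Q') = card (edges Q) \<and>
       Min (verts Q' - verts Q) > Min (verts Q - verts Q')"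

definition lsp :: "('a::linorder set \<Rightarrow> nat) \<Rightarrow> 'a sgraph \<Rightarrow> 'a \<Rightarrow> 'a \<Rightarrow> 'a sgraph" where
  "lsp w G a b = (THE Q. Q \<in> paths_of G a b \<and> (\<forall>Q'\<in>paths_of G a b. Q' \<noteq> Q \<longrightarrow> lex_less w Q Q'))"

definition lex_short :: "('a::linorder set \<Rightarrow> nat) \<Rightarrow> 'a sgraph \<Rightarrow> 'a sgraph \<Rightarrow> bool" where
  "lex_short w G C \<longleftrightarrow> (\<forall>a\<in>verts C. \<forall>b\<in>verts C. subgraph (lsp w G a b) C)"

definition LSC :: "('a::linorder set \<Rightarrow> nat) \<Rightarrow> 'a sgraph \<Rightarrow> 'a sgraph set" where
  "LSC w G = {C. is_cycle C \<and> subgraph C G \<and> lex_short w G C}"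

end

theory Submission
  imports Defs
begin

text \<open>
  A connected subgraph \<open>F\<close> of \<open>G\<close> that contains the lex shortest paths of \<open>G\<close> between its vertices
  has the same lex shortest paths, so a cycle of \<open>F\<close> is lex short in \<open>F\<close> iff it is lex short in
  \<open>G\<close>. Both \<open>G1\<close> and \<open>G2\<close> are of this kind: pieces of lex shortest paths are lex shortest, and a
  path can enter or leave \<open>H\<close> only through \<open>u\<close> and \<open>v\<close>, between which it must follow \<open>P\<close>. A lex
  short cycle that meets \<open>H\<close> and passes through \<open>u\<close> and \<open>v\<close> contains \<open>P\<close>, which is then
  everything it has outside \<open>H\<close>; and \<open>G1\<close> and \<open>G2\<close> share only the path \<open>P\<close>, hence no cycle.

  To see that lex shortest paths exist, are unique and are inherited by pieces, the lexicographic
  order is encoded as an additive cost, positive on vertices and nonnegative on edges: a unit of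
  weight costs more than all vertices together, and a vertex costs \<open>2 ^ (n + 1) - 2 ^ r\<close>, where \<open>n\<close>
  is the number of vertices and \<open>r\<close> the number of larger ones, so that more vertices cost more and
  among sets of equal size the one containing the least distinguishing vertex is cheaper.
\<close>

section \<open>Walks and paths as vertex lists\<close>

lemma walk_edges_append:
  "walk_edges (xs @ ys) = walk_edges xs \<union> walk_edges ys \<union>
     (if xs = [] \<or> ys = [] then {} else {{last xs, hd ys}})"
  by (induction xs rule: walk_edges.induct; cases ys) auto

lemma walk_edges_split:
  "walk_edges (xs @ x # ys) = walk_edges (xs @ [x]) \<union> walk_edges (x # ys)"
  by (cases ys) (auto simp: walk_edges_append)

lemma walk_edges_infix: "walk_edges ys \<subseteq> walk_edges (xs @ ys @ zs)"
  by (auto simp: walk_edges_append)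

lemma walk_edges_rev [simp]: "walk_edges (rev xs) = walk_edges xs"
proof (induction xs rule: walk_edges.induct)
  case (1 a b xs)
  then show ?case
    by (cases "xs = []") (auto simp: walk_edges_append insert_commute[of b a "{}"])
qed simp_all

lemma walk_edges_subset: "e \<in> walk_edges xs \<Longrightarrow> e \<subseteq> set xs"
  by (induction xs rule: walk_edges.induct) auto

lemma finite_walk_edges [simp]: "finite (walk_edges xs)"
  by (induction xs rule: walk_edges.induct) auto

lemma card_walk_edge: "distinct xs \<Longrightarrow> e \<in> walk_edges xs \<Longrightarrow> card e = 2"
  by (induction xs rule: walk_edges.induct) auto

lemma walk_edges_splitE:
  assumes "e \<in> walk_edges xs"
  obtains as p q bs where "xs = as @ p # q # bs" "e = {p, q}"
  using assms
proof (induction xs arbitrary: thesis rule: walk_edges.induct)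
  case (1 a b xs)
  show ?case
  proof (cases "e = {a, b}")
    case True
    then show ?thesis using "1.prems"(1)[of "[]" a b xs] by simp
  next
    case False
    with "1.prems" have "e \<in> walk_edges (b # xs)" by simp
    then obtain as p q bs where "b # xs = as @ p # q # bs" "e = {p, q}"
      using "1.IH" by blast
    then show ?thesis using "1.prems"(1)[of "a # as" p q bs] by simp
  qed
qed simp_all

lemma vertex_in_walk_edge:
  assumes "x \<in> set xs" "2 \<le> length xs"
  shows "\<exists>e\<in>walk_edges xs. x \<in> e"
proof -
  obtain as bs where xs: "xs = as @ x # bs" using assms(1) by (metis split_list)
  show ?thesis
  proof (cases bs)
    case Nil
    with assms(2) xs have "as \<noteq> []" by auto
    with Nil xs show ?thesis by (auto simp: walk_edges_append)
  next
    case (Cons b cs)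
    with xs show ?thesis by (auto simp: walk_edges_append)
  qed
qed

lemma card_walk_edges: "distinct xs \<Longrightarrow> card (walk_edges xs) = length xs - 1"
proof (induction xs rule: walk_edges.induct)
  case (1 a b xs)
  then have "{a, b} \<notin> walk_edges (b # xs)"
    using walk_edges_subset[of "{a, b}" "b # xs"] by auto
  with 1 show ?case by simp
qed auto

definition list_graph :: "'a list \<Rightarrow> 'a sgraph" where
  "list_graph xs = \<lparr>verts = set xs, edges = walk_edges xs\<rparr>"

lemma list_graph_sel [simp]:
  "verts (list_graph xs) = set xs" "edges (list_graph xs) = walk_edges xs"
  by (simp_all add: list_graph_def)

lemma list_graph_rev [simp]: "list_graph (rev xs) = list_graph xs"
  by (simp add: list_graph_def)

text \<open>Paths are handled as vertex lists whose ends are read off by \<open>hd\<close> and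
  \<open>last\<close>; \<open>mem_paths_of\<close> translates back to graphs.\<close>

definition path_list :: "'a sgraph \<Rightarrow> 'a list \<Rightarrow> bool" where
  "path_list G xs \<longleftrightarrow> xs \<noteq> [] \<and> distinct xs \<and> set xs \<subseteq> verts G \<and> walk_edges xs \<subseteq> edges G"

lemma path_list_rev [simp]: "path_list G (rev xs) \<longleftrightarrow> path_list G xs"
  by (simp add: path_list_def)

lemma simple_graph_list_graph: "distinct xs \<Longrightarrow> simple_graph (list_graph xs)"
  using walk_edges_subset card_walk_edge by (fastforce simp: simple_graph_def)

lemma subgraph_list_graph: "path_list G xs \<Longrightarrow> subgraph (list_graph xs) G"
  by (simp add: path_list_def subgraph_def simple_graph_list_graph)

lemma mem_paths_of:
  "Q \<in> paths_of G a b \<longleftrightarrow> (\<exists>xs. path_list G xs \<and> hd xs = a \<and> last xs = b \<and> Q = list_graph xs)"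
proof
  assume "Q \<in> paths_of G a b"
  then show "\<exists>xs. path_list G xs \<and> hd xs = a \<and> last xs = b \<and> Q = list_graph xs"
    by (auto simp: paths_of_def is_path_def subgraph_def path_list_def list_graph_def)
next
  assume "\<exists>xs. path_list G xs \<and> hd xs = a \<and> last xs = b \<and> Q = list_graph xs"
  then obtain xs where "path_list G xs" "hd xs = a" "last xs = b" "Q = list_graph xs" by blast
  then show "Q \<in> paths_of G a b"
    using subgraph_list_graph[of G xs]
    by (auto simp: paths_of_def is_path_def path_list_def list_graph_def)
qed

lemma subgraph_trans: "subgraph A B \<Longrightarrow> subgraph B C \<Longrightarrow> subgraph A C"
  by (auto simp: subgraph_def)

lemma path_list_mono: "path_list A xs \<Longrightarrow> subgraph A B \<Longrightarrow> path_list B xs"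
  by (auto simp: path_list_def subgraph_def)

section \<open>Paths of least additive cost\<close>

text \<open>Strict positivity on vertices is what excludes ties between different paths on the same
  vertices; edges may be free, since weights may be 0.\<close>

locale positive_cost =
  fixes c :: "'a \<Rightarrow> int" and l :: "'a set \<Rightarrow> int"
  assumes c_pos: "c x > 0" and l_nonneg: "l e \<ge> 0"
begin

text \<open>Repetitions are counted, so that concatenating walks adds their costs and that of the
  joining edge; on distinct lists it is a sum over the graph of the path
  (\<open>cost_distinct\<close>).\<close>

fun cost :: "'a list \<Rightarrow> int" where
  "cost [] = 0"
| "cost [a] = c a"
| "cost (a # b # xs) = c a + l {a, b} + cost (b # xs)"

lemma cost_append:
  "cost (xs @ ys) = cost xs + cost ys + (if xs = [] \<or> ys = [] then 0 else l {last xs, hd ys})"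
proof (induction xs rule: cost.induct)
  case (2 a)
  then show ?case by (cases ys) auto
qed (auto)

lemma cost_nonneg: "cost xs \<ge> 0"
proof (induction xs rule: cost.induct)
  case (3 a b xs)
  then show ?case using c_pos[of a] l_nonneg[of "{a,b}"] by simp
qed (use c_pos in \<open>auto intro: less_imp_le\<close>)

lemma cost_pos: "xs \<noteq> [] \<Longrightarrow> cost xs > 0"
proof (induction xs rule: cost.induct)
  case (3 a b xs)
  then show ?case using c_pos[of a] l_nonneg[of "{a,b}"] by simp
qed (use c_pos in auto)

lemma cost_split: "cost (xs @ x # ys) = cost (xs @ [x]) + cost (x # ys) - c x"
  by (cases ys) (auto simp: cost_append)

lemma cost_distinct:
  "distinct xs \<Longrightarrow> cost xs = sum c (set xs) + sum l (walk_edges xs)"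
proof (induction xs rule: cost.induct)
  case (3 a b xs)
  then have "{a, b} \<notin> walk_edges (b # xs)"
    using walk_edges_subset[of "{a, b}" "b # xs"] by auto
  with 3 show ?case by simp
qed auto

lemma cost_rev [simp]: "cost (rev xs) = cost xs"
  by (induction xs rule: cost.induct) (auto simp: cost_append last_rev insert_commute)

text \<open>Exchanging pieces of paths produces walks that may repeat vertices. Dropping the loop
  between two occurrences of a vertex never raises the cost, because costs are nonnegative.\<close>

lemma walk_shortcut:
  assumes "zs \<noteq> []" "set zs \<subseteq> verts G" "walk_edges zs \<subseteq> edges G"
  obtains ys where "path_list G ys" "hd ys = hd zs" "last ys = last zs" "cost ys \<le> cost zs"
  using assms
proof (induction "length zs" arbitrary: zs thesis rule: less_induct)
  case less
  show ?case
  proof (cases "distinct zs")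
    case True
    with less.prems show ?thesis by (auto simp: path_list_def)
  next
    case False
    then obtain as x bs cs where zs: "zs = as @ [x] @ bs @ [x] @ cs"
      using not_distinct_decomp by blast
    let ?z = "as @ x # cs"
    have e: "walk_edges ?z \<subseteq> walk_edges zs"
      using walk_edges_split[of as x cs] walk_edges_split[of as x "bs @ x # cs"]
        walk_edges_split[of "x # bs" x cs] by (auto simp: zs)
    have "cost zs = cost (as @ [x]) + cost (x # bs @ [x]) + cost (x # cs) - 2 * c x"
      using cost_split[of as x "bs @ x # cs"] cost_split[of "x # bs" x cs] by (simp add: zs)
    moreover have "cost (x # bs @ [x]) \<ge> c x"
      using cost_append[of "x # bs" "[x]"] cost_nonneg[of "x # bs"] l_nonneg by simp
    ultimately have le: "cost ?z \<le> cost zs"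
      using cost_split[of as x cs] by simp
    have ends: "hd ?z = hd zs" "last ?z = last zs" by (auto simp: zs hd_append)
    obtain ys where "path_list G ys" "hd ys = hd ?z" "last ys = last ?z" "cost ys \<le> cost ?z"
      by (rule less.hyps[of ?z]) (use e less.prems in \<open>auto simp: zs\<close>)
    then show ?thesis using less.prems(1) le ends by simp
  qed
qed

definition cheapest :: "'a sgraph \<Rightarrow> 'a list \<Rightarrow> bool" where
  "cheapest G xs \<longleftrightarrow> path_list G xs \<and>
     (\<forall>ys. path_list G ys \<and> hd ys = hd xs \<and> last ys = last xs \<longrightarrow> cost xs \<le> cost ys)"

lemma cheapest_exists:
  assumes "path_list G zs"
  obtains xs where "cheapest G xs" "hd xs = hd zs" "last xs = last zs"
proof -
  let ?P = "\<lambda>xs. path_list G xs \<and> hd xs = hd zs \<and> last xs = last zs"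
  have "\<exists>xs. ?P xs \<and> (\<forall>ys. ?P ys \<longrightarrow> nat (cost xs) \<le> nat (cost ys))"
    using assms ex_has_least_nat[of ?P zs "\<lambda>xs. nat (cost xs)"] by blast
  then obtain xs where "?P xs" "\<And>ys. ?P ys \<Longrightarrow> nat (cost xs) \<le> nat (cost ys)" by blast
  then have "cheapest G xs" using cost_nonneg by (auto simp: cheapest_def nat_le_eq_zle)
  with \<open>?P xs\<close> that show ?thesis by blast
qed

text \<open>A cheaper replacement for the piece \<open>xs\<close> could be spliced into the whole
  path, and \<open>walk_shortcut\<close> would turn the result into a cheaper path with the same
  ends.\<close>

lemma cheapest_sublist:
  assumes "cheapest G (as @ xs @ bs)" "xs \<noteq> []"
  shows "cheapest G xs"
  unfolding cheapest_def
proof (intro conjI allI impI)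
  show "path_list G xs"
    using assms by (auto simp: cheapest_def path_list_def walk_edges_append split: if_splits)
  fix ys assume ys: "path_list G ys \<and> hd ys = hd xs \<and> last ys = last xs"
  let ?z = "as @ ys @ bs"
  have ne: "ys \<noteq> []" using ys by (simp add: path_list_def)
  have p: "path_list G (as @ xs @ bs)" using assms by (simp add: cheapest_def)
  have c: "cost ?z - cost ys = cost (as @ xs @ bs) - cost xs"
    using ys ne assms(2) by (simp add: cost_append hd_append)
  have ends: "hd ?z = hd (as @ xs @ bs)" "last ?z = last (as @ xs @ bs)"
    using ys ne assms(2) by (simp_all add: hd_append last_append)
  have "walk_edges ?z \<subseteq> walk_edges (as @ xs @ bs) \<union> walk_edges ys"
    using ys ne assms(2) by (auto simp: walk_edges_append hd_append split: if_splits)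
  with p ys have "walk_edges ?z \<subseteq> edges G" "set ?z \<subseteq> verts G"
    by (auto simp: path_list_def)
  then obtain zs where "path_list G zs" "hd zs = hd ?z" "last zs = last ?z" "cost zs \<le> cost ?z"
    using walk_shortcut[of ?z G] ne by blast
  with assms(1) ends have "cost (as @ xs @ bs) \<le> cost ?z"
    by (force simp: cheapest_def)
  with c show "cost xs \<le> cost ys" by simp
qed

text \<open>Two cheapest paths through the same vertices agree: at the first vertices \<open>x \<noteq> y\<close> where
  they part, each of them could jump directly to the vertex chosen by the other one, and these
  two shortcuts together are cheaper than the two paths together.\<close>

lemma cheapest_same_set:
  assumes xs: "cheapest G xs" and ys: "cheapest G ys"
    and ends: "hd ys = hd xs" "last ys = last xs" and set: "set xs = set ys"
  shows "xs = ys"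
proof (rule ccontr)
  assume neq: "xs \<noteq> ys"
  have px: "path_list G xs" and py: "path_list G ys"
    using xs ys by (simp_all add: cheapest_def)
  then have len: "length xs = length ys"
    using set by (metis distinct_card path_list_def)
  obtain ps x y as bs where sp: "xs = ps @ x # as" "ys = ps @ y # bs" "x \<noteq> y"
    using same_length_different[OF neq len] by auto
  have "ps \<noteq> []" using sp ends by auto
  have "x \<in> set bs" "y \<in> set as"
    using sp set px py by (auto simp: path_list_def)
  then obtain as1 as2 bs1 bs2 where as: "as = as1 @ y # as2" and bs: "bs = bs1 @ x # bs2"
    by (metis split_list)
  let ?X = "ps @ y # as2" and ?Y = "ps @ x # bs2"
  have "path_list G ?X"
    using px py walk_edges_split[of "x # as1" y as2] unfolding path_list_def sp as bs by (auto simp: walk_edges_append split: if_splits)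
  moreover have "path_list G ?Y"
    using px py walk_edges_split[of "y # bs1" x bs2] unfolding path_list_def sp as bs by (auto simp: walk_edges_append split: if_splits)
  moreover have "hd ?X = hd xs" "last ?X = last xs" "hd ?Y = hd ys" "last ?Y = last ys"
    using \<open>ps \<noteq> []\<close> by (simp_all add: sp as bs)
  ultimately have "cost xs \<le> cost ?X" "cost ys \<le> cost ?Y"
    using xs ys by (simp_all add: cheapest_def)
  \<comment> \<open>\<open>?X\<close> enters \<open>y\<close> by an edge of \<open>ys\<close> and
    \<open>?Y\<close> enters \<open>x\<close> by an edge of \<open>xs\<close>, so only the skipped
    pieces and the edges leaving them remain.\<close>
  moreover have "cost xs + cost ys = cost ?X + cost ?Y + cost (x # as1) + cost (y # bs1)
      + l {last (x # as1), y} + l {last (y # bs1), x}"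
    using \<open>ps \<noteq> []\<close> cost_append[of "x # as1" "y # as2"] cost_append[of "y # bs1" "x # bs2"]
      by (simp add: sp as bs cost_append)
  ultimately show False
    using cost_pos[of "x # as1"] cost_pos[of "y # bs1"]
      l_nonneg[of "{last (x # as1), y}"] l_nonneg[of "{last (y # bs1), x}"] by simp
qed

end

section \<open>The lexicographic order as a cost\<close>

definition lex_vertex_cost :: "'a::linorder set \<Rightarrow> 'a \<Rightarrow> int" where
  "lex_vertex_cost V v = 2 ^ (card V + 1) - 2 ^ card {x \<in> V. v < x}"

text \<open>The factor strictly exceeds the total vertex cost of any path on vertices from
  \<open>V\<close> (\<open>path_weight_bound\<close>), so one unit of weight outweighs every
  difference in vertices.\<close>

definition lex_edge_cost :: "'a set \<Rightarrow> ('a set \<Rightarrow> nat) \<Rightarrow> 'a set \<Rightarrow> int" where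
  "lex_edge_cost V w e = int (card V + 1) * 2 ^ (card V + 1) * int (w e)"

lemma lex_rank_le: "finite V \<Longrightarrow> card {x \<in> V. v < x} \<le> card V"
  by (rule card_mono) auto

text \<open>The smaller of two vertices has more vertices above it, so ranks are distinct, and a sum
  of distinct powers of two with exponents below \<open>k\<close> stays below
  \<open>2 ^ k\<close>.\<close>

lemma sum_rank_powers_less:
  fixes V :: "'a::linorder set"
  assumes "finite V" "A \<subseteq> V" "\<And>a. a \<in> A \<Longrightarrow> card {x \<in> V. a < x} < k"
  shows "(\<Sum>a\<in>A. 2 ^ card {x \<in> V. a < x}) < (2 ^ k :: int)"
proof -
  let ?r = "\<lambda>a. card {x \<in> V. a < x}"
  have "?r b < ?r a" if "a < b" "b \<in> V" for a b
    by (rule psubset_card_mono) (use assms(1) that in auto)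
  then have inj: "inj_on ?r A"
    using assms(2) by (metis (no_types, lifting) inj_onI linorder_neqE order_less_irrefl subsetD)
  have "(\<Sum>a\<in>A. 2 ^ ?r a) = (\<Sum>i\<in>?r ` A. 2 ^ i :: int)"
    by (simp add: sum.reindex[OF inj])
  also have "\<dots> \<le> (\<Sum>i<k. 2 ^ i)"
    by (rule sum_mono2) (use assms(3) in auto)
  also have "\<dots> < 2 ^ k"
    by (induction k) auto
  finally show ?thesis .
qed

text \<open>Separates the number of vertices from the tie-breaking part. For \<open>A\<close> inside
  a finite \<open>V\<close> the latter is the binary number whose digits mark the ranks of the
  elements of \<open>A\<close>.\<close>

lemma sum_lex_vertex_cost:
  "sum (lex_vertex_cost V) A =
     int (card A) * 2 ^ (card V + 1) - (\<Sum>a\<in>A. 2 ^ card {x \<in> V. a < x})"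
  by (simp add: lex_vertex_cost_def sum_subtractf)

locale finite_weighted_graph =
  fixes G :: "'a::linorder sgraph" and w :: "'a set \<Rightarrow> nat"
  assumes finite_verts: "finite (verts G)"
begin

sublocale positive_cost "lex_vertex_cost (verts G)" "lex_edge_cost (verts G) w"
proof
  fix x
  have "card {y \<in> verts G. x < y} < card (verts G) + 1"
    using lex_rank_le[OF finite_verts, of x] by simp
  then have "(2::int) ^ card {y \<in> verts G. x < y} < 2 ^ (card (verts G) + 1)"
    by (rule power_strict_increasing) simp
  then show "lex_vertex_cost (verts G) x > 0"
    by (simp add: lex_vertex_cost_def)
qed (simp add: lex_edge_cost_def)

definition better :: "'a list \<Rightarrow> 'a list \<Rightarrow> bool" where
  "better xs ys \<longleftrightarrow> lex_less w (list_graph xs) (list_graph ys)"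

lemma path_weight_bound:
  assumes "path_list G xs"
  shows "0 < sum (lex_vertex_cost (verts G)) (set xs)"
    and "sum (lex_vertex_cost (verts G)) (set xs)
      < int (card (verts G) + 1) * 2 ^ (card (verts G) + 1)"
proof -
  show "0 < sum (lex_vertex_cost (verts G)) (set xs)"
    by (rule sum_pos) (use assms c_pos in \<open>auto simp: path_list_def\<close>)
  have "card (set xs) \<le> card (verts G)"
    using assms finite_verts by (simp add: path_list_def card_mono)
  then have "int (card (set xs)) * 2 ^ (card (verts G) + 1)
      \<le> int (card (verts G)) * 2 ^ (card (verts G) + 1)"
    by (intro mult_right_mono) auto
  moreover have "sum (lex_vertex_cost (verts G)) (set xs)
      \<le> int (card (set xs)) * 2 ^ (card (verts G) + 1)"
    by (simp add: sum_lex_vertex_cost sum_nonneg)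
  moreover have "(0::int) < 2 ^ (card (verts G) + 1)" by simp
  ultimately show "sum (lex_vertex_cost (verts G)) (set xs)
      < int (card (verts G) + 1) * 2 ^ (card (verts G) + 1)"
    by (simp only: of_nat_add of_nat_1 distrib_right mult_1_left)
qed

lemma cost_path:
  assumes "path_list G xs"
  shows "cost xs = sum (lex_vertex_cost (verts G)) (set xs)
    + int (card (verts G) + 1) * 2 ^ (card (verts G) + 1) * int (path_weight w (list_graph xs))"
  using assms cost_distinct[of xs]
  by (simp add: path_list_def path_weight_def lex_edge_cost_def sum_distrib_left)

text \<open>The cost is \<open>K\<close> times the weight plus a vertex part strictly between 0 and
  \<open>K\<close>; the vertex part is \<open>M\<close> times the number of vertices minus some
  \<open>R\<close> with \<open>0 \<le> R < M\<close>. Each alternative of \<open>lex_less\<close> is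
  thus settled on its own scale.\<close>

lemma better_imp_cost_less:
  assumes xs: "path_list G xs" and ys: "path_list G ys" and b: "better xs ys"
  shows "cost xs < cost ys"
proof -
  define n where "n = card (verts G)"
  define M :: int where "M = 2 ^ (n + 1)"
  define K where "K = int (n + 1) * M"
  define W where "W zs = path_weight w (list_graph zs)" for zs :: "'a list"
  define C where "C A = sum (lex_vertex_cost (verts G)) A" for A
  define r where "r a = card {x \<in> verts G. a < x}" for a
  define R where "R A = (\<Sum>a\<in>A. 2 ^ r a :: int)" for A
  note defs = n_def M_def K_def W_def C_def
  have M: "M > 0" by (simp add: M_def)
  have C: "C A = int (card A) * M - R A" for A
    by (simp add: sum_lex_vertex_cost M_def n_def C_def R_def r_def)
  have R_less: "R A < M" if "A \<subseteq> verts G" for A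
    unfolding R_def r_def M_def n_def
    by (rule sum_rank_powers_less)
       (use that finite_verts lex_rank_le[OF finite_verts] in \<open>auto simp: less_Suc_eq_le\<close>)
  have R_nonneg: "R A \<ge> 0" for A by (simp add: R_def sum_nonneg)
  have cost: "cost zs = C (set zs) + K * int (W zs)" and bd: "0 < C (set zs)" "C (set zs) < K"
    if "path_list G zs" for zs
    using cost_path[OF that] path_weight_bound[OF that] by (simp_all add: defs)
  have K: "K > 0" using bd[OF xs] by simp
  have sub: "set xs \<subseteq> verts G" "set ys \<subseteq> verts G"
    using xs ys by (auto simp: path_list_def)
  \<comment> \<open>Positivity is recorded because truncated subtraction would otherwise confuse 0
    and 1 vertices.\<close>
  have card_edges: "card (walk_edges zs) = card (set zs) - 1" "card (set zs) > 0"
    if "path_list G zs" for zs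
    using that card_walk_edges[of zs]
    by (auto simp: path_list_def distinct_card card_gt_0_iff)
  consider (weight) "W xs < W ys" | (edges) "W xs = W ys" "card (set xs) < card (set ys)"
    | (order) "W xs = W ys" "card (set xs) = card (set ys)"
        "Min (set xs - set ys) < Min (set ys - set xs)"
    using b card_edges[OF xs] card_edges[OF ys]
    by (auto simp: better_def lex_less_def W_def)
  then show ?thesis
  proof cases
    case weight
    then have "K * (int (W xs) + 1) \<le> K * int (W ys)"
      using K by (intro mult_left_mono) auto
    then show ?thesis
      using cost[OF xs] cost[OF ys] bd[OF xs] bd[OF ys] by (simp add: distrib_left)
  next
    case edges
    have "(int (card (set xs)) + 1) * M \<le> int (card (set ys)) * M"
      using edges(2) M by (intro mult_right_mono) auto
    then have "C (set xs) < C (set ys)"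
      using R_less[OF sub(2)] R_nonneg[of "set xs"] by (simp add: C distrib_right)
    with edges(1) show ?thesis using cost[OF xs] cost[OF ys] by simp
  next
    case order
    let ?A = "set xs - set ys" and ?B = "set ys - set xs"
    \<comment> \<open>Equal sets would make both minima the unspecified \<open>Min {}\<close>, which
      is not below itself.\<close>
    have "set xs \<noteq> set ys" using order(3) by auto
    then have "?A \<noteq> {}"
      using order(2) card_subset_eq[of "set ys" "set xs"] by auto
    then have m: "Min ?A \<in> ?A" by (intro Min_in) auto
    \<comment> \<open>All of \<open>?B\<close> lies above \<open>Min ?A\<close> and so has smaller
      rank: the leading binary digit contributed by \<open>Min ?A\<close> alone beats
      \<open>?B\<close>.\<close>
    have "R ?B < 2 ^ r (Min ?A)"
      unfolding R_def r_def
    proof (rule sum_rank_powers_less)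
      fix a assume a: "a \<in> ?B"
      then have "Min ?A < a"
        using order.strict_trans2[OF order(3) Min_le] by simp
      then show "card {x \<in> verts G. a < x} < card {x \<in> verts G. Min ?A < x}"
        by (intro psubset_card_mono) (use finite_verts sub a in auto)
    qed (use finite_verts sub in auto)
    also have "\<dots> \<le> R ?A"
      unfolding R_def by (rule member_le_sum) (use m in auto)
    finally have "R ?B < R ?A" .
    moreover have "R (set zs) = R (set xs \<inter> set ys) + R (set zs - (set xs \<inter> set ys))"
      if "set xs \<inter> set ys \<subseteq> set zs" for zs
      unfolding R_def using that by (subst sum.subset_diff) auto
    from this[of xs] this[of ys] have "R (set xs) = R (set xs \<inter> set ys) + R ?A"
      "R (set ys) = R (set xs \<inter> set ys) + R ?B"
      by (simp_all add: Diff_Int)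
    ultimately have "C (set xs) < C (set ys)" using order(2) by (simp add: C)
    with order(1) show ?thesis using cost[OF xs] cost[OF ys] by simp
  qed
qed

text \<open>Different vertex sets of equal size have nonempty disjoint differences, whose minima
  differ; sets of different size give different numbers of edges.\<close>

lemma better_total:
  assumes xs: "path_list G xs" and ys: "path_list G ys" and neq: "set xs \<noteq> set ys"
  shows "better xs ys \<or> better ys xs"
proof (cases "card (set xs) = card (set ys)")
  case True
  with neq have "set xs - set ys \<noteq> {}" "set ys - set xs \<noteq> {}"
    using card_subset_eq[of "set ys" "set xs"] card_subset_eq[of "set xs" "set ys"] by auto
  then have "Min (set xs - set ys) \<in> set xs - set ys" "Min (set ys - set xs) \<in> set ys - set xs"
    by (auto intro!: Min_in simp del: Diff_iff)
  then have "Min (set xs - set ys) \<noteq> Min (set ys - set xs)"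
    by (metis Diff_iff)
  then show ?thesis by (auto simp: better_def lex_less_def)
next
  case False
  have "card (walk_edges zs) = card (set zs) - 1" "card (set zs) > 0" if "path_list G zs" for zs
    using that card_walk_edges[of zs]
    by (auto simp: path_list_def distinct_card card_gt_0_iff)
  from this[OF xs] this[OF ys] False have "card (walk_edges xs) \<noteq> card (walk_edges ys)"
    by linarith
  then show ?thesis by (auto simp: better_def lex_less_def)
qed

text \<open>The costs agree, so neither path is better than the other and totality forces equal
  vertex sets.\<close>

lemma cheapest_unique:
  assumes xs: "cheapest G xs" and ys: "cheapest G ys"
    and ends: "hd ys = hd xs" "last ys = last xs"
  shows "xs = ys"
proof -
  have p: "path_list G xs" "path_list G ys" using xs ys by (simp_all add: cheapest_def)
  have "cost xs = cost ys" using xs ys ends by (force simp: cheapest_def intro: antisym)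
  then have "set xs = set ys"
    using better_total[OF p] better_imp_cost_less[OF p] better_imp_cost_less[OF p(2,1)] by auto
  with cheapest_same_set xs ys ends show ?thesis by blast
qed

text \<open>Uniqueness rules out equal cost. For paths on the same vertices, where the third
  alternative of \<open>lex_less\<close> is false, the difference in cost must be one in weight;
  otherwise \<open>better_total\<close> applies.\<close>

lemma cheapest_better:
  assumes xs: "cheapest G xs" and ys: "path_list G ys"
    and ends: "hd ys = hd xs" "last ys = last xs" and neq: "ys \<noteq> xs"
  shows "better xs ys"
proof -
  have p: "path_list G xs" using xs by (simp add: cheapest_def)
  have "cost xs \<noteq> cost ys"
  proof
    assume "cost xs = cost ys"
    with xs ys ends have "cheapest G ys" by (auto simp: cheapest_def)
    with cheapest_unique[OF xs _ ends] neq show False by blast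
  qed
  with xs ys ends have less: "cost xs < cost ys" by (force simp: cheapest_def)
  show ?thesis
  proof (cases "set xs = set ys")
    case True
    then have "path_weight w (list_graph xs) \<noteq> path_weight w (list_graph ys)"
      using less cost_path[OF p] cost_path[OF ys] by auto
    then show ?thesis
      using True less better_imp_cost_less[OF ys p]
      by (auto simp: better_def lex_less_def neq_iff)
  next
    case False
    with better_total[OF p ys] better_imp_cost_less[OF ys p] less show ?thesis by auto
  qed
qed

lemma cheapest_rev:
  assumes "cheapest G xs"
  shows "cheapest G (rev xs)"
  unfolding cheapest_def
proof (intro conjI allI impI)
  show "path_list G (rev xs)" using assms by (simp add: cheapest_def)
  fix ys assume "path_list G ys \<and> hd ys = hd (rev xs) \<and> last ys = last (rev xs)"
  then have "path_list G (rev ys)" "hd (rev ys) = hd xs" "last (rev ys) = last xs"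
    by (simp_all add: hd_rev last_rev)
  with assms have "cost xs \<le> cost (rev ys)" unfolding cheapest_def by blast
  then show "cost (rev xs) \<le> cost ys" by simp
qed

text \<open>The piece of \<open>ps\<close> between the ends of \<open>xs\<close> is cheapest too, so
  by uniqueness it is \<open>xs\<close> or its reversal, depending on the order of the ends along
  \<open>ps\<close>.\<close>

lemma cheapest_convex:
  assumes ps: "cheapest G ps" and xs: "cheapest G xs"
    and "hd xs \<in> set ps" "last xs \<in> set ps"
  shows "walk_edges xs \<subseteq> walk_edges ps"
proof -
  obtain as bs where 1: "ps = as @ hd xs # bs" using assms(3) by (metis split_list)
  have "\<exists>as ms bs. ps = as @ ms @ bs \<and> ms \<noteq> [] \<and>
    (hd ms = hd xs \<and> last ms = last xs \<or> hd ms = last xs \<and> last ms = hd xs)"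
  proof -
    consider "last xs = hd xs" | "last xs \<in> set as" | "last xs \<in> set bs"
      using assms(4) 1 by auto
    then show ?thesis
    proof cases
      case 1
      then show ?thesis using \<open>ps = as @ hd xs # bs\<close>
        by (intro exI[of _ as] exI[of _ "[hd xs]"] exI[of _ bs]) simp
    next
      case 2
      then obtain cs ds where "as = cs @ last xs # ds" by (metis split_list)
      then show ?thesis using 1
        by (intro exI[of _ cs] exI[of _ "last xs # ds @ [hd xs]"] exI[of _ bs]) simp
    next
      case 3
      then obtain cs ds where "bs = cs @ last xs # ds" by (metis split_list)
      then show ?thesis using 1
        by (intro exI[of _ as] exI[of _ "hd xs # cs @ [last xs]"] exI[of _ ds]) simp
    qed
  qed
  then obtain as ms bs where ms: "ps = as @ ms @ bs" "ms \<noteq> []"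
    "hd ms = hd xs \<and> last ms = last xs \<or> hd ms = last xs \<and> last ms = hd xs" by blast
  have c: "cheapest G ms" using cheapest_sublist ps ms by simp
  have "xs \<noteq> []" using xs by (simp add: cheapest_def path_list_def)
  from ms(3) have "ms = xs \<or> ms = rev xs"
    using cheapest_unique[OF xs c] cheapest_unique[OF cheapest_rev[OF xs] c]
    by (auto simp: hd_rev last_rev)
  then have "walk_edges ms = walk_edges xs" by auto
  moreover have "walk_edges ms \<subseteq> walk_edges ps" unfolding ms(1) by (rule walk_edges_infix)
  ultimately show ?thesis by simp
qed

end

section \<open>Lex shortest paths and lex short cycles in subgraphs\<close>

lemma lex_less_asym: "lex_less w A B \<Longrightarrow> \<not> lex_less w B A"
  by (auto simp: lex_less_def)

text \<open>Asymmetry of \<open>lex_less\<close> leaves room for only one such path, which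
  determines the \<open>THE\<close> in \<open>lsp\<close>.\<close>

lemma lsp_eqI:
  assumes "Q \<in> paths_of G a b" "\<And>Q'. Q' \<in> paths_of G a b \<Longrightarrow> Q' \<noteq> Q \<Longrightarrow> lex_less w Q Q'"
  shows "lsp w G a b = Q"
  unfolding lsp_def
proof (rule the_equality)
  show "Q \<in> paths_of G a b \<and> (\<forall>Q'\<in>paths_of G a b. Q' \<noteq> Q \<longrightarrow> lex_less w Q Q')"
    using assms by simp
  fix Q' assume Q': "Q' \<in> paths_of G a b \<and> (\<forall>Q\<in>paths_of G a b. Q \<noteq> Q' \<longrightarrow> lex_less w Q' Q)"
  show "Q' = Q"
  proof (rule ccontr)
    assume "Q' \<noteq> Q"
    then have "lex_less w Q Q'" "lex_less w Q' Q" using assms Q' by simp_all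
    then show False by (simp add: lex_less_asym)
  qed
qed

lemma paths_of_sym: "paths_of G a b = paths_of G b a"
proof -
  have "paths_of G a b \<subseteq> paths_of G b a" for a b
    unfolding subset_iff mem_paths_of by (metis hd_rev last_rev list_graph_rev path_list_rev)
  then show ?thesis by blast
qed

lemma lsp_sym: "lsp w G a b = lsp w G b a"
  by (simp add: lsp_def paths_of_sym[of G a b])

lemma connected_graph_iff:
  "connected_graph G \<longleftrightarrow> verts G \<noteq> {} \<and>
     (\<forall>a\<in>verts G. \<forall>b\<in>verts G. \<exists>xs. path_list G xs \<and> hd xs = a \<and> last xs = b)"
proof -
  have "paths_of G a b \<noteq> {} \<longleftrightarrow> (\<exists>xs. path_list G xs \<and> hd xs = a \<and> last xs = b)" for a b
    unfolding ex_in_conv[symmetric] mem_paths_of by blast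
  then show ?thesis by (simp add: connected_graph_def)
qed

locale connected_weighted_graph = finite_weighted_graph +
  assumes connected: "connected_graph G"
begin

lemma lsp_cheapest:
  assumes "cheapest G xs"
  shows "lsp w G (hd xs) (last xs) = list_graph xs"
proof (rule lsp_eqI)
  show "list_graph xs \<in> paths_of G (hd xs) (last xs)"
    using assms by (auto simp: mem_paths_of cheapest_def)
  fix Q assume "Q \<in> paths_of G (hd xs) (last xs)" "Q \<noteq> list_graph xs"
  then show "lex_less w (list_graph xs) Q"
    using cheapest_better[OF assms] by (auto simp: mem_paths_of better_def)
qed

lemma lsp_obtain:
  assumes "a \<in> verts G" "b \<in> verts G"
  obtains xs where "cheapest G xs" "hd xs = a" "last xs = b" "lsp w G a b = list_graph xs"
  using assms connected cheapest_exists lsp_cheapest by (metis connected_graph_iff)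

text \<open>Paths of \<open>G'\<close> are paths of \<open>G\<close>, so a path that beats all
  others in \<open>G\<close> still does so among those of \<open>G'\<close>.\<close>

lemma lsp_subgraph:
  assumes "subgraph G' G" "a \<in> verts G" "b \<in> verts G" "subgraph (lsp w G a b) G'"
  shows "lsp w G' a b = lsp w G a b"
proof -
  obtain xs where xs: "cheapest G xs" "hd xs = a" "last xs = b" "lsp w G a b = list_graph xs"
    using lsp_obtain assms by blast
  show ?thesis
    unfolding xs(4)
  proof (rule lsp_eqI)
    show "list_graph xs \<in> paths_of G' a b"
      using xs assms(4) unfolding mem_paths_of
      by (auto simp: cheapest_def path_list_def subgraph_def intro!: exI[of _ xs])
    fix Q assume "Q \<in> paths_of G' a b" "Q \<noteq> list_graph xs"
    then show "lex_less w (list_graph xs) Q"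
      using cheapest_better[OF xs(1)] xs(2,3) path_list_mono[OF _ assms(1)]
      by (auto simp: mem_paths_of better_def)
  qed
qed

lemma LSC_restrict:
  assumes "C \<in> LSC w G" "subgraph C G'" "subgraph G' G"
  shows "C \<in> LSC w G'"
proof -
  have "subgraph (lsp w G' a b) C" if "a \<in> verts C" "b \<in> verts C" for a b
  proof -
    have ab: "a \<in> verts G" "b \<in> verts G" using that assms by (auto simp: subgraph_def)
    have "subgraph (lsp w G a b) C" using that assms(1) by (simp add: LSC_def lex_short_def)
    with lsp_subgraph[OF assms(3) ab] assms(2) show ?thesis by (metis subgraph_trans)
  qed
  with assms show ?thesis by (simp add: LSC_def lex_short_def)
qed

text \<open>Being lex short in \<open>G'\<close> says nothing about paths of \<open>G\<close> that
  leave \<open>G'\<close>, hence the closure hypothesis.\<close>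

lemma LSC_extend:
  assumes "C \<in> LSC w G'" "subgraph G' G"
    and "\<And>a b. a \<in> verts G' \<Longrightarrow> b \<in> verts G' \<Longrightarrow> subgraph (lsp w G a b) G'"
  shows "C \<in> LSC w G"
proof -
  have "subgraph (lsp w G a b) C" if "a \<in> verts C" "b \<in> verts C" for a b
  proof -
    have ab: "a \<in> verts G'" "b \<in> verts G'" "a \<in> verts G" "b \<in> verts G"
      using that assms by (auto simp: LSC_def subgraph_def)
    have "subgraph (lsp w G' a b) C" using that assms(1) by (simp add: LSC_def lex_short_def)
    with lsp_subgraph[OF assms(2) ab(3,4) assms(3)[OF ab(1,2)]] show ?thesis by simp
  qed
  with assms subgraph_trans show ?thesis by (auto simp: LSC_def lex_short_def)
qed

end

section \<open>Segments of walks and cycles\<close>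

text \<open>The segment grows in both directions until it meets \<open>H\<close> or the list ends.
  \<open>H\<close> is any set: it is used for stretches outside a subgraph and, with a complement,
  for stretches inside.\<close>

lemma maximal_segment:
  assumes "set ms \<inter> H = {}"
  obtains as' m1 m2 bs' where "as @ ms @ bs = as' @ (m1 @ ms @ m2) @ bs'"
    "set (m1 @ ms @ m2) \<inter> H = {}"
    "as' = [] \<or> last as' \<in> H" "bs' = [] \<or> hd bs' \<in> H"
proof -
  have "\<exists>as' m1. as = as' @ m1 \<and> set m1 \<inter> H = {} \<and> (as' = [] \<or> last as' \<in> H)"
  proof (induction as rule: rev_induct)
    case (snoc a as)
    show ?case
    proof (cases "a \<in> H")
      case True
      then show ?thesis by (intro exI[of _ "as @ [a]"] exI[of _ "[]"]) simp
    next
      case False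
      from snoc obtain as' m1 where "as = as' @ m1" "set m1 \<inter> H = {}" "as' = [] \<or> last as' \<in> H"
        by blast
      with False show ?thesis by (intro exI[of _ as'] exI[of _ "m1 @ [a]"]) simp
    qed
  qed simp
  moreover have "\<exists>m2 bs'. bs = m2 @ bs' \<and> set m2 \<inter> H = {} \<and> (bs' = [] \<or> hd bs' \<in> H)"
  proof (induction bs)
    case (Cons b bs)
    show ?case
    proof (cases "b \<in> H")
      case True
      then show ?thesis by (intro exI[of _ "[]"] exI[of _ "b # bs"]) simp
    next
      case False
      from Cons obtain m2 bs' where "bs = m2 @ bs'" "set m2 \<inter> H = {}" "bs' = [] \<or> hd bs' \<in> H"
        by blast
      with False show ?thesis by (intro exI[of _ "b # m2"] exI[of _ bs']) simp
    qed
  qed simp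
  ultimately obtain as' m1 m2 bs' where
    "as = as' @ m1" "set m1 \<inter> H = {}" "as' = [] \<or> last as' \<in> H"
    "bs = m2 @ bs'" "set m2 \<inter> H = {}" "bs' = [] \<or> hd bs' \<in> H" by blast
  with assms show ?thesis by (intro that[of as' m1 m2 bs']) auto
qed

lemma walk_crosses:
  "xs \<noteq> [] \<Longrightarrow> hd xs \<in> A \<Longrightarrow> last xs \<notin> A \<Longrightarrow> \<exists>a b. {a, b} \<in> walk_edges xs \<and> a \<in> A \<and> b \<notin> A"
proof (induction xs rule: walk_edges.induct)
  case (1 a b xs)
  then show ?case by (cases "b \<in> A") fastforce+
qed auto

text \<open>The edge \<open>{p, q}\<close> is the only one of the path that joins its two halves, so
  a walk inside the path from one half to the other uses it.\<close>

lemma path_crosses: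
  assumes "distinct (as @ p # q # bs)" "xs \<noteq> []"
    and "walk_edges xs \<subseteq> walk_edges (as @ p # q # bs)"
    and "hd xs \<in> set (as @ [p])" "last xs \<in> set (q # bs)"
  shows "{p, q} \<in> walk_edges xs"
proof -
  let ?A = "set (as @ [p])"
  have "last xs \<notin> ?A" using assms(1,5) by auto
  then obtain a b where ab: "{a, b} \<in> walk_edges xs" "a \<in> ?A" "b \<notin> ?A"
    using walk_crosses[of xs ?A] assms(2,4) by blast
  then have "{a, b} \<in> walk_edges (as @ [p]) \<union> {{p, q}} \<union> walk_edges (q # bs)"
    using assms(3) walk_edges_split[of as p "q # bs"] by auto
  moreover have "{a, b} \<notin> walk_edges (as @ [p])"
    using ab walk_edges_subset[of "{a, b}" "as @ [p]"] by auto
  moreover have "{a, b} \<notin> walk_edges (q # bs)"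
    using ab walk_edges_subset[of "{a, b}" "q # bs"] assms(1) by auto
  ultimately show ?thesis using ab(1) by auto
qed

text \<open>The closing edge of the cycle would be an edge of the path, and the rest of the cycle,
  joining its ends inside the path, would have to use it a second time.\<close>

lemma cycle_not_in_path:
  assumes "is_cycle C" "distinct ps"
  shows "\<not> edges C \<subseteq> walk_edges ps"
proof
  assume sub: "edges C \<subseteq> walk_edges ps"
  obtain xs where xs: "3 \<le> length xs" "distinct xs"
    "edges C = insert {last xs, hd xs} (walk_edges xs)"
    using assms(1) by (auto simp: is_cycle_def)
  then obtain a b c ys where abc: "xs = a # b # c # ys"
    by (metis Suc_le_length_iff numeral_3_eq_3)
  then have ne: "xs \<noteq> []" by simp
  \<comment> \<open>Length at least 3 matters: the last vertex differs from \<open>b\<close>, and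
    the only walk edge at \<open>a\<close> is \<open>{a, b}\<close>.\<close>
  have not_edge: "{last xs, hd xs} \<notin> walk_edges xs"
  proof
    assume e: "{last xs, hd xs} \<in> walk_edges xs"
    have "last xs \<in> set (c # ys)" by (simp add: abc)
    moreover have "{last xs, hd xs} \<in> insert {a, b} (walk_edges (b # c # ys))"
      using e by (simp add: abc)
    ultimately show False
      using xs(2) walk_edges_subset[of "{last xs, hd xs}" "b # c # ys"]
      by (auto simp: abc doubleton_eq_iff simp del: last.simps walk_edges.simps)
  qed
  from sub xs(3) have "{last xs, hd xs} \<in> walk_edges ps" by auto
  then obtain as p q bs where ps: "ps = as @ p # q # bs" "{last xs, hd xs} = {p, q}"
    by (rule walk_edges_splitE)
  have "{p, q} \<in> walk_edges xs"
  proof (cases "hd xs = p")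
    case True
    with ps(2) have "last xs = q" by (auto simp: doubleton_eq_iff)
    with True show ?thesis
      using path_crosses[of as p q bs xs] assms(2) sub xs(2,3) ne by (simp add: ps(1))
  next
    case False
    with ps(2) have "last xs = p" "hd xs = q" by (auto simp: doubleton_eq_iff)
    then show ?thesis
      using path_crosses[of as p q bs "rev xs"] assms(2) sub xs(2,3) ne
      by (simp add: ps(1) hd_rev last_rev)
  qed
  with not_edge ps(2) show False by simp
qed

text \<open>Repeating \<open>h\<close> at the end makes the closing edge an ordinary edge of the
  list, so that facts on walks apply.\<close>

lemma cycle_rotate:
  assumes "is_cycle C" "h \<in> verts C"
  obtains xs where "distinct (h # xs)" "2 \<le> length xs" "verts C = set (h # xs)"
    "edges C = walk_edges (h # xs @ [h])"
proof -
  obtain ys where ys: "3 \<le> length ys" "distinct ys" "verts C = set ys"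
    "edges C = insert {last ys, hd ys} (walk_edges ys)"
    using assms(1) by (auto simp: is_cycle_def)
  obtain as bs where s: "ys = as @ h # bs" using assms(2) ys(3) by (metis split_list)
  have "walk_edges (h # (bs @ as) @ [h]) = insert {last ys, hd ys} (walk_edges ys)"
  proof (cases as)
    case Nil
    then show ?thesis using walk_edges_append[of "h # bs" "[h]"] by (simp add: s)
  next
    case (Cons a as')
    have "walk_edges (h # (bs @ as) @ [h]) = walk_edges ((h # bs) @ (as @ [h]))" by simp
    also have "\<dots> = insert {last ys, hd ys} (walk_edges ys)"
      using walk_edges_append[of "h # bs" "as @ [h]"] walk_edges_split[of as h bs]
      by (auto simp: s Cons)
    finally show ?thesis .
  qed
  with ys s show ?thesis by (intro that[of "bs @ as"]) auto
qed

section \<open>Separations of order two\<close>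

text \<open>Adjoining the edge, and \<open>q\<close> if it is new, keeps \<open>H\<close> connected,
  since a path from \<open>p\<close> can be prolonged to \<open>q\<close>. By maximality the edge
  was already there.\<close>

lemma component_closed:
  assumes H: "H \<in> components_of K" and e: "{p, q} \<in> edges K" and K: "simple_graph K"
    and p: "p \<in> verts H"
  shows "{p, q} \<in> edges H"
proof -
  let ?L = "\<lparr>verts = insert q (verts H), edges = insert {p, q} (edges H)\<rparr>"
  have HK: "subgraph H K" and conn: "connected_graph H"
    and max: "\<And>L. subgraph L K \<Longrightarrow> connected_graph L \<Longrightarrow> subgraph H L \<Longrightarrow> L = H"
    using H by (auto simp: components_of_def)
  have L: "subgraph H ?L" "subgraph ?L K"
    using HK e K p by (auto simp: subgraph_def simple_graph_def)
  have "\<exists>xs. path_list ?L xs \<and> hd xs = a \<and> last xs = b"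
    if ab: "a \<in> verts ?L" "b \<in> verts ?L" for a b
  proof -
    have old: "\<exists>xs. path_list H xs \<and> hd xs = a \<and> last xs = b"
      if "a \<in> verts H" "b \<in> verts H" for a b
      using conn that by (simp add: connected_graph_iff)
    have to_q: "\<exists>xs. path_list ?L xs \<and> hd xs = q \<and> last xs = b"
      if "b \<in> verts H" "q \<notin> verts H" for b
    proof -
      obtain xs where xs: "path_list H xs" "hd xs = p" "last xs = b" using old p \<open>b \<in> verts H\<close> by blast
      then have "path_list ?L (q # xs)"
        using \<open>q \<notin> verts H\<close> by (cases xs) (auto simp: path_list_def insert_commute)
      with xs show ?thesis by (intro exI[of _ "q # xs"]) (auto simp: path_list_def)
    qed
    consider "a \<in> verts H" "b \<in> verts H" | "a = q" "b = q"
      | "a = q" "b \<in> verts H" "q \<notin> verts H" | "a \<in> verts H" "b = q" "q \<notin> verts H"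
      using ab by auto
    then show ?thesis
    proof cases
      case 1
      then show ?thesis using old path_list_mono[OF _ L(1)] by blast
    next
      case 2
      then show ?thesis by (intro exI[of _ "[q]"]) (simp add: path_list_def)
    next
      case 3
      then show ?thesis using to_q by blast
    next
      case 4
      then obtain xs where "path_list ?L xs" "hd xs = q" "last xs = a" using to_q by blast
      with 4 show ?thesis by (intro exI[of _ "rev xs"]) (simp add: hd_rev last_rev)
    qed
  qed
  then have "connected_graph ?L" by (simp add: connected_graph_iff)
  with max L have "?L = H" by blast
  then have "edges ?L = edges H" by (rule arg_cong)
  then show ?thesis by auto
qed

text \<open>\<open>closed\<close> forces an edge leaving \<open>H\<close> to end in \<open>u\<close>
  or \<open>v\<close> (\<open>neighbour\<close>), and also makes \<open>H\<close> induced in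
  \<open>G\<close>, as \<open>H\<close> contains neither of them.\<close>

locale two_separation = connected_weighted_graph +
  fixes u v :: 'a and H :: "'a sgraph"
  assumes simple: "simple_graph G"
    and uv: "u \<in> verts G" "v \<in> verts G" "u \<noteq> v" "u \<notin> verts H" "v \<notin> verts H"
    and H: "subgraph H G"
    and closed: "{p, q} \<in> edges G \<Longrightarrow> p \<in> verts H \<Longrightarrow> q \<notin> {u, v} \<Longrightarrow> {p, q} \<in> edges H"
    and avoids: "verts (lsp w G u v) \<inter> verts H = {}"
begin

definition side1 :: "'a sgraph" where
  "side1 = \<lparr>verts = verts H \<union> verts (lsp w G u v),
     edges = edges H \<union> edges (lsp w G u v)
       \<union> {{a, b} | a b. a \<in> verts H \<and> b \<in> {u, v} \<and> {a, b} \<in> edges G}\<rparr>"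

definition side2 :: "'a sgraph" where
  "side2 = induced G (verts G - verts H)"

lemma neighbour: "{p, q} \<in> edges G \<Longrightarrow> p \<in> verts H \<Longrightarrow> q \<notin> verts H \<Longrightarrow> q = u \<or> q = v"
  using closed[of p q] H by (fastforce simp: subgraph_def simple_graph_def)

lemma P_path:
  obtains ps where "cheapest G ps" "hd ps = u" "last ps = v" "lsp w G u v = list_graph ps"
    "u \<in> set ps" "v \<in> set ps" "ps \<noteq> []"
proof -
  obtain ps where ps: "cheapest G ps" "hd ps = u" "last ps = v" "lsp w G u v = list_graph ps"
    using lsp_obtain uv by blast
  moreover from this have "ps \<noteq> []" by (simp add: cheapest_def path_list_def)
  ultimately show ?thesis using that hd_in_set last_in_set by metis
qed

lemma side1_simple: "simple_graph side1"
proof -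
  obtain ps where ps: "cheapest G ps" "lsp w G u v = list_graph ps" "u \<in> set ps" "v \<in> set ps"
    by (rule P_path)
  then have "simple_graph (list_graph ps)"
    by (intro simple_graph_list_graph) (simp add: cheapest_def path_list_def)
  with ps H simple show ?thesis
    by (fastforce simp: side1_def simple_graph_def subgraph_def)
qed

lemma side1_subgraph: "subgraph side1 G"
proof -
  obtain ps where ps: "cheapest G ps" "lsp w G u v = list_graph ps" by (rule P_path)
  then have "subgraph (lsp w G u v) G"
    by (simp add: cheapest_def subgraph_list_graph)
  with side1_simple H show ?thesis by (auto simp: side1_def subgraph_def)
qed

lemma side2_subgraph: "subgraph side2 G"
  using simple by (auto simp: side2_def induced_def subgraph_def simple_graph_def)

lemma edge_in_side1:
  assumes "{p, q} \<in> edges G" "p \<in> verts H \<or> q \<in> verts H"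
  shows "{p, q} \<in> edges side1"
proof -
  have *: "{p, q} \<in> edges side1" if "{p, q} \<in> edges G" "p \<in> verts H" for p q
    using that closed[of p q] by (auto simp: side1_def)
  show ?thesis using assms *[of p q] *[of q p] by (auto simp: insert_commute)
qed

section \<open>Lex shortest paths relative to the two sides\<close>

lemma lsp_between_uv:
  assumes "cheapest G xs" "hd xs \<in> {u, v}" "last xs \<in> {u, v}" "hd xs \<noteq> last xs"
  shows "lsp w G u v = list_graph xs"
  using assms lsp_cheapest[OF assms(1)] lsp_sym[of w G u v] by auto

text \<open>A stretch inside \<open>H\<close> is entered and left through \<open>u\<close> and
  \<open>v\<close>, each used once. Together with them it would be the lex shortest
  \<open>u\<close>-\<open>v\<close> path, which avoids \<open>H\<close>.\<close>

lemma cheapest_avoids: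
  assumes xs: "cheapest G xs" and ends: "hd xs \<notin> verts H" "last xs \<notin> verts H"
  shows "set xs \<inter> verts H = {}"
proof (rule ccontr)
  assume "set xs \<inter> verts H \<noteq> {}"
  then obtain h where h: "h \<in> set xs" "h \<in> verts H" by blast
  then obtain as bs where s: "xs = as @ [h] @ bs" by (metis append_Cons append_Nil split_list)
  \<comment> \<open>Here the avoided set is the complement, so the maximal stretch lies inside
    \<open>H\<close>.\<close>
  obtain as' m1 m2 bs' where m: "as @ [h] @ bs = as' @ (m1 @ [h] @ m2) @ bs'"
    "set (m1 @ [h] @ m2) \<inter> - verts H = {}"
    "as' = [] \<or> last as' \<in> - verts H" "bs' = [] \<or> hd bs' \<in> - verts H"
    by (rule maximal_segment[of "[h]" "- verts H" as bs]) (use h in auto)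
  let ?m = "m1 @ [h] @ m2"
  have m_in: "hd ?m \<in> verts H" "last ?m \<in> verts H"
    using m(2) hd_in_set[of ?m] last_in_set[of ?m] by blast+
  have xs_eq: "xs = as' @ ?m @ bs'" by (simp only: s m(1))
  have "as' \<noteq> []" using ends(1) m_in(1) by (auto simp: xs_eq hd_append split: if_splits)
  moreover have "bs' \<noteq> []" using ends(2) m_in(2) by (auto simp: xs_eq last_append split: if_splits)
  ultimately obtain as0 c d bs0 where cd: "as' = as0 @ [c]" "bs' = d # bs0"
    by (metis append_butlast_last_id list.exhaust)
  have xs': "xs = as0 @ (c # ?m @ [d]) @ bs0" by (simp add: xs_eq cd)
  have path: "path_list G xs" using xs by (simp add: cheapest_def)
  have "{c, hd ?m} \<in> walk_edges (c # ?m @ [d])"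
    by (cases m1) auto
  moreover have "{last ?m, d} \<in> walk_edges (c # ?m @ [d])"
    using walk_edges_append[of "c # ?m" "[d]"] by simp
  moreover have "walk_edges (c # ?m @ [d]) \<subseteq> walk_edges xs"
    unfolding xs' by (rule walk_edges_infix)
  ultimately have e: "{hd ?m, c} \<in> edges G" "{last ?m, d} \<in> edges G"
    using path by (auto simp: path_list_def insert_commute)
  have "c \<notin> verts H" "d \<notin> verts H" using m(3,4) cd by auto
  then have "c \<in> {u, v}" "d \<in> {u, v}"
    using neighbour e m_in by blast+
  moreover have "c \<noteq> d" using path by (auto simp: xs' path_list_def)
  moreover have "cheapest G (c # ?m @ [d])"
    using xs cheapest_sublist[of G as0 "c # ?m @ [d]" bs0] by (simp add: xs')
  ultimately have "lsp w G u v = list_graph (c # ?m @ [d])"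
    using lsp_between_uv[of "c # ?m @ [d]"] by simp
  then have "h \<in> verts (lsp w G u v)" by simp
  with h avoids show False by blast
qed

text \<open>A maximal stretch of a cheapest path outside \<open>H\<close> starts and ends on the lex shortest
  \<open>u\<close>-\<open>v\<close> path, because \<open>H\<close> can be entered and left only through \<open>u\<close> and \<open>v\<close>; such a stretch
  is a piece of that path.\<close>

lemma cheapest_in_side1:
  assumes xs: "cheapest G xs" and ends: "hd xs \<in> verts side1" "last xs \<in> verts side1"
  shows "subgraph (list_graph xs) side1"
proof -
  have path: "path_list G xs" using xs by (simp add: cheapest_def)
  obtain ps where ps: "cheapest G ps" "lsp w G u v = list_graph ps" "u \<in> set ps" "v \<in> set ps"
    by (rule P_path)
  have edges: "e \<in> edges side1" if e: "e \<in> walk_edges xs" for e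
  proof -
    obtain as p q bs where s: "xs = as @ p # q # bs" "e = {p, q}"
      using e by (rule walk_edges_splitE)
    have eG: "{p, q} \<in> edges G" using e path s(2) by (auto simp: path_list_def)
    show ?thesis
    proof (cases "p \<in> verts H \<or> q \<in> verts H")
      case True
      with eG edge_in_side1 s(2) show ?thesis by blast
    next
      case False
      obtain as' m1 m2 bs' where m: "as @ [p, q] @ bs = as' @ (m1 @ [p, q] @ m2) @ bs'"
        "set (m1 @ [p, q] @ m2) \<inter> verts H = {}"
        "as' = [] \<or> last as' \<in> verts H" "bs' = [] \<or> hd bs' \<in> verts H"
        by (rule maximal_segment[of "[p, q]" "verts H" as bs]) (use False in auto)
      define mid where "mid = m1 @ [p, q] @ m2"
      have mid: "xs = as' @ mid @ bs'" "mid \<noteq> []" "set mid \<inter> verts H = {}"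
        using m s(1) by (simp_all add: mid_def)
      have sub: "walk_edges xs \<subseteq> edges G" using path by (simp add: path_list_def)
      have notH: "hd mid \<notin> verts H" "last mid \<notin> verts H"
        using mid(2,3) hd_in_set last_in_set by blast+
      have "hd mid \<in> set ps"
      proof (cases "as' = []")
        case True
        with ends(1) mid notH ps(2) show ?thesis by (simp add: side1_def)
      next
        case False
        then have "{last as', hd mid} \<in> edges G"
          using sub mid(2) by (auto simp: mid(1) walk_edges_append)
        with neighbour notH m(3) False ps(3,4) show ?thesis by blast
      qed
      moreover have "last mid \<in> set ps"
      proof (cases "bs' = []")
        case True
        with ends(2) mid notH ps(2) show ?thesis by (simp add: side1_def)
      next
        case False
        then have "{hd bs', last mid} \<in> edges G"
          using sub mid(2) by (auto simp: mid(1) walk_edges_append insert_commute)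
        with neighbour notH m(4) False ps(3,4) show ?thesis by blast
      qed
      moreover have "cheapest G mid"
        using cheapest_sublist xs mid by simp
      ultimately have "walk_edges mid \<subseteq> walk_edges ps"
        using cheapest_convex ps(1) by blast
      moreover have "e \<in> walk_edges mid"
        by (simp add: mid_def walk_edges_append[of m1] s(2))
      ultimately show ?thesis using ps(2) by (auto simp: side1_def)
    qed
  qed
  have "set xs \<subseteq> verts side1"
  proof (cases "2 \<le> length xs")
    case True
    show ?thesis
    proof
      fix a assume "a \<in> set xs"
      with True obtain e where "e \<in> walk_edges xs" "a \<in> e" using vertex_in_walk_edge by metis
      with edges side1_simple show "a \<in> verts side1" by (auto simp: simple_graph_def)
    qed
  next
    case False
    with path obtain a where "xs = [a]" by (cases xs) (auto simp: path_list_def Suc_le_eq)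
    with ends show ?thesis by simp
  qed
  with edges path show ?thesis
    by (auto simp: subgraph_def simple_graph_list_graph path_list_def)
qed

lemma lsp_in_side1:
  assumes "a \<in> verts side1" "b \<in> verts side1"
  shows "subgraph (lsp w G a b) side1"
proof -
  have "a \<in> verts G" "b \<in> verts G" using assms side1_subgraph by (auto simp: subgraph_def)
  then obtain xs where "cheapest G xs" "hd xs = a" "last xs = b" "lsp w G a b = list_graph xs"
    by (rule lsp_obtain)
  with cheapest_in_side1 assms show ?thesis by simp
qed

lemma lsp_in_side2:
  assumes "a \<in> verts side2" "b \<in> verts side2"
  shows "subgraph (lsp w G a b) side2"
proof -
  have ab: "a \<in> verts G" "b \<in> verts G" "a \<notin> verts H" "b \<notin> verts H"
    using assms by (auto simp: side2_def induced_def)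
  then obtain xs where xs: "cheapest G xs" "hd xs = a" "last xs = b" "lsp w G a b = list_graph xs"
    using lsp_obtain by blast
  then have "set xs \<inter> verts H = {}" using cheapest_avoids ab by blast
  moreover have "path_list G xs" using xs(1) by (simp add: cheapest_def)
  ultimately show ?thesis
    using walk_edges_subset[of _ xs]
    by (fastforce simp: xs(4) subgraph_def simple_graph_list_graph path_list_def side2_def
        induced_def)
qed

text \<open>Cutting the cycle open at a vertex of \<open>H\<close> turns it into a path that contains the lex
  shortest \<open>u\<close>-\<open>v\<close> path. A stretch of the cycle outside \<open>H\<close> runs between \<open>u\<close> and \<open>v\<close> as well,
  so all its edges must be used by the lex shortest path.\<close>

lemma LSC_in_side1:
  assumes C: "C \<in> LSC w G" and h: "h \<in> verts C" "h \<in> verts H"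
  shows "subgraph C side1"
proof -
  have cyc: "is_cycle C" and CG: "subgraph C G" and short: "lex_short w G C"
    using C by (simp_all add: LSC_def)
  obtain xs where xs: "distinct (h # xs)" "2 \<le> length xs" "verts C = set (h # xs)"
    "edges C = walk_edges (h # xs @ [h])"
    using cycle_rotate[OF cyc h(1)] by blast
  obtain ps where ps: "cheapest G ps" "hd ps = u" "last ps = v" "lsp w G u v = list_graph ps"
    "u \<in> set ps" "v \<in> set ps" "ps \<noteq> []" by (rule P_path)
  have edges: "e \<in> edges side1" if e: "e \<in> edges C" for e
  proof -
    obtain as p q bs where s: "h # xs @ [h] = as @ p # q # bs" "e = {p, q}"
      using e xs(4) walk_edges_splitE by metis
    have eG: "{p, q} \<in> edges G" using e CG s(2) by (auto simp: subgraph_def)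
    show ?thesis
    proof (cases "p \<in> verts H \<or> q \<in> verts H")
      case True
      with eG edge_in_side1 s(2) show ?thesis by blast
    next
      case False
      obtain as' m1 m2 bs' where m: "as @ [p, q] @ bs = as' @ (m1 @ [p, q] @ m2) @ bs'"
        "set (m1 @ [p, q] @ m2) \<inter> verts H = {}"
        "as' = [] \<or> last as' \<in> verts H" "bs' = [] \<or> hd bs' \<in> verts H"
        by (rule maximal_segment[of "[p, q]" "verts H" as bs]) (use False in auto)
      define mid where "mid = m1 @ [p, q] @ m2"
      have mid: "h # xs @ [h] = as' @ mid @ bs'" "mid \<noteq> []" "set mid \<inter> verts H = {}"
        using m s(1) by (simp_all add: mid_def)
      have sub: "walk_edges (h # xs @ [h]) \<subseteq> edges G"
        using CG xs(4) by (simp add: subgraph_def)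
      have notH: "hd mid \<notin> verts H" "last mid \<notin> verts H"
        using mid(2,3) hd_in_set last_in_set by blast+
      have "as' \<noteq> []"
      proof
        assume "as' = []"
        then have "hd mid = h" using mid(1,2) by (metis append_Nil hd_append2 list.sel(1))
        with notH h show False by simp
      qed
      moreover have "bs' \<noteq> []"
      proof
        assume "bs' = []"
        then have "last mid = h" using mid(1,2)
          by (metis append_Cons append_Nil2 last_appendR last_snoc)
        with notH h show False by simp
      qed
      ultimately obtain as2 bs2 where ab: "as' = h # as2" "bs' = bs2 @ [h]"
        using mid(1) by (metis append_Cons append_assoc append_butlast_last_id last_appendR
            last_snoc list.exhaust list.sel(1) mid(2) append_is_Nil_conv)
      have xs': "xs = as2 @ mid @ bs2" using mid(1) by (simp add: ab)
      have "{last as', hd mid} \<in> edges G" "{hd bs', last mid} \<in> edges G"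
        using sub mid(2) \<open>as' \<noteq> []\<close> \<open>bs' \<noteq> []\<close>
        by (auto simp: mid(1) walk_edges_append insert_commute)
      then have in_uv: "hd mid \<in> {u, v}" "last mid \<in> {u, v}"
        using neighbour notH m(3,4) \<open>as' \<noteq> []\<close> \<open>bs' \<noteq> []\<close> by blast+
      have hd_mid: "hd mid \<in> set (m1 @ [p])" by (cases m1) (simp_all add: mid_def)
      have last_mid: "last mid \<in> set (q # m2)" by (simp add: mid_def)
      have xs'': "xs = (as2 @ m1) @ p # q # (m2 @ bs2)" by (simp add: xs' mid_def)
      \<comment> \<open>The ends of the stretch lie on different sides of the edge
        \<open>{p, q}\<close>, and \<open>xs\<close> repeats no vertex.\<close>
      have "hd mid \<noteq> last mid" using hd_mid last_mid xs(1) by (auto simp: xs'')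
      with in_uv have cd: "hd mid = u \<and> last mid = v \<or> hd mid = v \<and> last mid = u" by auto
      have "hd mid \<in> set xs" "last mid \<in> set xs"
        using mid(2) by (simp_all add: xs')
      with cd have "u \<in> verts C" "v \<in> verts C" by (auto simp: xs(3))
      with short have "subgraph (list_graph ps) C"
        by (simp add: lex_short_def flip: ps(4))
      then have "walk_edges ps \<subseteq> walk_edges (h # xs @ [h])"
        by (simp add: subgraph_def xs(4))
      moreover have "h \<notin> set ps" using avoids h(2) ps(4) by auto
      moreover have "walk_edges (h # xs @ [h]) = insert {h, hd xs} (insert {last xs, h} (walk_edges xs))"
        using xs(2) walk_edges_append[of xs "[h]"] by (cases xs) auto
      \<comment> \<open>The two edges of the cycle at \<open>h\<close> are not on the lex shortest
        path, which misses \<open>h\<close>; its edges all lie on the opened cycle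
        \<open>xs\<close>.\<close>
      ultimately have sub_ps: "walk_edges ps \<subseteq> walk_edges xs"
        using walk_edges_subset[of _ ps] by blast
      \<comment> \<open>Oriented like \<open>mid\<close>, the path runs from the side of
        \<open>p\<close> to the side of \<open>q\<close> and must cross
        \<open>{p, q}\<close>.\<close>
      obtain ps' where ps': "ps' = ps \<or> ps' = rev ps" "hd ps' = hd mid" "last ps' = last mid"
        using cd ps(2,3) hd_rev last_rev by metis
      have "{p, q} \<in> walk_edges ps'"
      proof (rule path_crosses)
        show "walk_edges ps' \<subseteq> walk_edges ((as2 @ m1) @ p # q # (m2 @ bs2))"
          using sub_ps ps'(1) by (auto simp: xs'' simp del: append_assoc)
        show "distinct ((as2 @ m1) @ p # q # (m2 @ bs2))" using xs(1) by (auto simp: xs'')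
      qed (use ps' hd_mid last_mid ps(7) in auto)
      then have "{p, q} \<in> walk_edges ps" using ps'(1) by auto
      with s(2) ps(4) show ?thesis by (simp add: side1_def)
    qed
  qed
  have "set (h # xs) \<subseteq> verts side1"
  proof
    fix a assume "a \<in> set (h # xs)"
    then obtain e where "e \<in> edges C" "a \<in> e"
      using vertex_in_walk_edge[of a "h # xs @ [h]"] xs(2,4) by auto
    with edges side1_simple show "a \<in> verts side1" by (auto simp: simple_graph_def)
  qed
  with edges CG show ?thesis by (auto simp: subgraph_def xs(3))
qed

lemma LSC_separation: "LSC w G = LSC w side1 \<union> LSC w side2" "LSC w side1 \<inter> LSC w side2 = {}"
proof -
  have "C \<in> LSC w side1 \<union> LSC w side2" if C: "C \<in> LSC w G" for C
  proof (cases "verts C \<inter> verts H = {}")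
    case True
    with C have "subgraph C side2"
      by (fastforce simp: LSC_def subgraph_def simple_graph_def side2_def induced_def)
    with C LSC_restrict side2_subgraph show ?thesis by blast
  next
    case False
    with C LSC_in_side1 LSC_restrict side1_subgraph show ?thesis by blast
  qed
  moreover have "LSC w side1 \<subseteq> LSC w G"
    using LSC_extend side1_subgraph lsp_in_side1 by blast
  moreover have "LSC w side2 \<subseteq> LSC w G"
    using LSC_extend side2_subgraph lsp_in_side2 by blast
  ultimately show "LSC w G = LSC w side1 \<union> LSC w side2" by blast
  show "LSC w side1 \<inter> LSC w side2 = {}"
  proof (rule ccontr)
    assume "LSC w side1 \<inter> LSC w side2 \<noteq> {}"
    then obtain C where C: "is_cycle C" "subgraph C side1" "subgraph C side2"
      by (auto simp: LSC_def)
    obtain ps where ps: "cheapest G ps" "lsp w G u v = list_graph ps" by (rule P_path)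
    \<comment> \<open>Of the edges of \<open>side1\<close>, only those of the lex shortest path have
      both ends outside \<open>H\<close>.\<close>
    have "e \<in> walk_edges ps" if "e \<in> edges C" for e
    proof -
      have e: "e \<in> edges side1" "e \<subseteq> verts G - verts H"
        using that C by (auto simp: subgraph_def side2_def induced_def)
      have "e \<notin> edges H"
      proof
        assume "e \<in> edges H"
        with H have "e \<subseteq> verts H" "e \<noteq> {}" by (auto simp: subgraph_def simple_graph_def)
        with e(2) show False by blast
      qed
      with e ps(2) show ?thesis by (auto simp: side1_def)
    qed
    with cycle_not_in_path[OF C(1)] ps(1) show False
      by (auto simp: cheapest_def path_list_def)
  qed
qed

end

theorem theorem3:
  fixes G G1 G2 H P S :: "'a::linorder sgraph"
    and w :: "'a set \<Rightarrow> nat"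
    and u v x y z :: 'a
  assumes "simple_graph G"
    and "finite (verts G)"
    and "connected_graph G"
    and "partial_two_tree G"
    and "\<not> outerplanar G"
    and "u \<in> verts G" and "v \<in> verts G"
    and "distinct [u, v, x, y, z]"
    and "subdivision_of (complete_bipartite {u, v} {x, y, z}) S"
    and "subgraph S G"
    and "card (components_of (delete_verts G {u, v})) \<ge> 3"
    and "P = lsp w G u v"
    and "H \<in> components_of (delete_verts G {u, v})"
    and "verts P \<inter> verts H = {}"
    and "edges P \<inter> edges H = {}"
    and "G1 = \<lparr>verts = verts H \<union> verts P,
               edges = edges H \<union> edges P
                 \<union> {{a, b} | a b. a \<in> verts H \<and> b \<in> {u, v} \<and> {a, b} \<in> edges G}\<rparr>"
    and "G2 = induced G (verts G - verts H)"
  shows "LSC w G = LSC w G1 \<union> LSC w G2 \<and> LSC w G1 \<inter> LSC w G2 = {}"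
proof -
  let ?D = "delete_verts G {u, v}"
  have D: "simple_graph ?D" "subgraph ?D G" "verts ?D = verts G - {u, v}"
    "edges ?D = {e \<in> edges G. e \<subseteq> verts G - {u, v}}"
    using assms(1) by (auto simp: delete_verts_def induced_def simple_graph_def subgraph_def)
  have HD: "subgraph H ?D" using assms(13) by (simp add: components_of_def)
  interpret two_separation G w u v H
  proof
    show "subgraph H G" using HD D(2) subgraph_trans by blast
    show "u \<notin> verts H" "v \<notin> verts H" using HD D(3) by (auto simp: subgraph_def)
    show "u \<noteq> v" using assms(8) by simp
    show "verts (lsp w G u v) \<inter> verts H = {}" using assms(12,14) by simp
    \<comment> \<open>The edge avoids \<open>u\<close> and \<open>v\<close>, so it survives their
      deletion, and a component contains all edges at its vertices.\<close>
    fix p q assume pq: "{p, q} \<in> edges G" "p \<in> verts H" "q \<notin> {u, v}"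
    then have "{p, q} \<in> edges ?D"
      using assms(1) HD D(3,4) by (auto simp: simple_graph_def subgraph_def)
    with component_closed[OF assms(13)] D(1) pq(2) show "{p, q} \<in> edges H" by blast
  qed (use assms in auto)
  have "G1 = side1" "G2 = side2" using assms(12,16,17) by (simp_all add: side1_def side2_def)
  with LSC_separation show ?thesis by simp
qed

end
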